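(* For every $n\in\mathbb{N}$ the set \[ \{1\}\cup\{p^i\leq n: p\in\mathbb{P},\ i\in\{1,2,3\}\}\cup\{pq:\{p,q\}\in M(n)\}\cup\{a_1a_2,a_3a_4,\dots,a_{2\lfloor s/2\rfloor-1}a_{2\lfloor s/2\rfloor}\}, \] where $F(n)=\{a_1,a_2,\dots,a_s\}$ (with $a_1,\dots,a_s$ distinct), is a maximum $(n,3)$-shelf.
   Context: $\mathbb{N}$ is the set of positive integers, $\mathbb{P}$ the set of primes, $[n]:=\{1,2,\dots,n\}$, and $\mathbb{P}(x,y):=\mathbb{P}\cap(x,y]$ for real $x,y$. For a finite set $A\subseteq\mathbb{N}$ and a prime $p$, $o_p(A):=|A\cap p\mathbb{N}|$ is the number of elements of $A$ divisible by $p$. For positive integers $k,n$, an $(n,k)$-shelf is a set $A\subseteq[n]$ with $o_p(A)\leq k$ for all $p\in\mathbb{P}$; a maximum $(n,k)$-shelf is an $(n,k)$-shelf of maximal cardinality among all $(n,k)$-shelves. The bipartite graph $G(n)$: one side (left) has one vertex for each prime in $\mathbb{P}(\sqrt[3]{n},\sqrt{n})$; the other side (right) has two vertices (copies) for each prime in $\mathbb{P}(\sqrt{n},n)$; the vertex multiset is thus $\mathbb{P}(\sqrt[3]{n},\sqrt{n})\cup\mathbb{P}(\sqrt{n},n)\cup\mathbb{P}(\sqrt{n},n)$, and each vertex is identified with its prime. There is an edge exactly between every left vertex $p$ and right vertex $q$ with $pq\leq n$. The matching $M(n)$ in $G(n)$ is constructed as follows. Start with the empty matching $M$. Repeat the following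 step until it is no longer possible: take the smallest not yet matched right vertex $q$ (the two copies of the same prime being taken one after the other), find the largest not yet matched left vertex $p$ adjacent to $q$, and add the edge $\{p,q\}$ to $M$. The resulting matching is $M(n)$, and $F(n)\subseteq\mathbb{P}(\sqrt[3]{n},\sqrt{n})$ denotes the set of left vertices not matched by $M(n)$. *)

theory Defs
  imports Complex_Main "HOL-Computational_Algebra.Primes" "HOL-Library.While_Combinator"
begin

definition primes_between :: "real \<Rightarrow> real \<Rightarrow> nat set" where
  "primes_between x y = {p. prime p \<and> x < real p \<and> real p \<le> y}"

definition num_multiples :: "nat \<Rightarrow> nat set \<Rightarrow> nat" where
  "num_multiples p A = card {a \<in> A. p dvd a}"

definition shelf :: "nat \<Rightarrow> nat \<Rightarrow> nat set \<Rightarrow> bool" where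
  "shelf n k A \<longleftrightarrow> A \<subseteq> {1..n} \<and> (\<forall>p. prime p \<longrightarrow> num_multiples p A \<le> k)"

definition maximum_shelf :: "nat \<Rightarrow> nat \<Rightarrow> nat set \<Rightarrow> bool" where
  "maximum_shelf n k A \<longleftrightarrow> shelf n k A \<and> (\<forall>B. shelf n k B \<longrightarrow> card B \<le> card A)"

definition left_vertices :: "nat \<Rightarrow> nat set" where
  "left_vertices n = primes_between (root 3 (real n)) (sqrt (real n))"

text \<open>A right vertex is a pair \<open>(q, c)\<close>: the copy number \<open>c\<close> of the prime \<open>q\<close>.\<close>

definition right_vertices :: "nat \<Rightarrow> (nat \<times> nat) set" where
  "right_vertices n = primes_between (sqrt (real n)) (real n) \<times> {1, 2}"

definition edges :: "nat \<Rightarrow> (nat \<times> nat \<times> nat) set" where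
  "edges n = {(p, v). p \<in> left_vertices n \<and> v \<in> right_vertices n \<and> p * fst v \<le> n}"

definition free_right :: "nat \<Rightarrow> (nat \<times> nat \<times> nat) set \<Rightarrow> (nat \<times> nat) set" where
  "free_right n M = right_vertices n - snd ` M"

definition next_right :: "nat \<Rightarrow> (nat \<times> nat \<times> nat) set \<Rightarrow> nat \<times> nat" where
  "next_right n M =
     (let q = Min (fst ` free_right n M) in (q, Min {c. (q, c) \<in> free_right n M}))"

definition free_neighbours :: "nat \<Rightarrow> (nat \<times> nat \<times> nat) set \<Rightarrow> nat set" where
  "free_neighbours n M = {p \<in> left_vertices n - fst ` M. (p, next_right n M) \<in> edges n}"

text \<open>The second conjunct is about the smallest free right vertex only. Every neighbour of a
  larger right vertex is also a neighbour of that one, so stopping when it has no free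
  neighbour loses no edge.\<close>

definition extendable :: "nat \<Rightarrow> (nat \<times> nat \<times> nat) set \<Rightarrow> bool" where
  "extendable n M \<longleftrightarrow> free_right n M \<noteq> {} \<and> free_neighbours n M \<noteq> {}"

definition extend :: "nat \<Rightarrow> (nat \<times> nat \<times> nat) set \<Rightarrow> (nat \<times> nat \<times> nat) set" where
  "extend n M = insert (Max (free_neighbours n M), next_right n M) M"

definition greedy_matching :: "nat \<Rightarrow> (nat \<times> nat \<times> nat) set" where
  "greedy_matching n = while (extendable n) (extend n) {}"

definition unmatched_left :: "nat \<Rightarrow> nat set" where
  "unmatched_left n = left_vertices n - fst ` greedy_matching n"

lemma finite_right_vertices: "finite (right_vertices n)"
proof -
  have "primes_between (sqrt (real n)) (real n) \<subseteq> {..n}"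
    by (auto simp: primes_between_def)
  then show ?thesis
    unfolding right_vertices_def by (meson finite.intros finite_SigmaI finite_atMost finite_subset)
qed

lemma next_right_in_free_right:
  assumes "free_right n M \<noteq> {}"
  shows "next_right n M \<in> free_right n M"
proof -
  let ?U = "free_right n M"
  define q where "q = Min (fst ` ?U)"
  have fin: "finite ?U"
    by (simp add: free_right_def finite_right_vertices)
  have "q \<in> fst ` ?U"
    unfolding q_def using fin assms by (intro Min_in) auto
  then have ne: "{c. (q, c) \<in> ?U} \<noteq> {}" by auto
  have "{c. (q, c) \<in> ?U} \<subseteq> snd ` ?U" by force
  then have "finite {c. (q, c) \<in> ?U}"
    using fin by (meson finite_imageI finite_subset)
  from Min_in[OF this ne] show ?thesis
    by (simp add: next_right_def q_def Let_def)
qed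

text \<open>The loop terminates, so \<^const>\<open>greedy_matching\<close> really is its result.\<close>

lemma greedy_matching_terminates:
  "while_option (extendable n) (extend n) {} = Some (greedy_matching n)"
proof -
  have "\<exists>M. while_option (extendable n) (extend n) {} = Some M"
  proof (rule measure_while_option_Some[where P = "\<lambda>_. True"
        and f = "\<lambda>M. card (free_right n M)"])
    fix M assume "extendable n M"
    then have "next_right n M \<in> free_right n M"
      by (intro next_right_in_free_right) (simp add: extendable_def)
    then have "free_right n (extend n M) \<subset> free_right n M"
      by (auto simp: free_right_def extend_def)
    then show "True \<and> card (free_right n (extend n M)) < card (free_right n M)"
      by (simp add: psubset_card_mono free_right_def finite_right_vertices)
  qed simp
  then show ?thesis
    by (auto simp: greedy_matching_def while_def)
qed

end

theory Submission
  imports Defs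
begin

text \<open>For a prime \<open>p\<close> let \<open>cap p\<close> be \<open>3\<close> minus the number of its powers \<open>p, p\<^sup>2, p\<^sup>3\<close> up to \<open>n\<close>; it is
  \<open>1\<close> on the left vertices, \<open>2\<close> on the right ones and \<open>0\<close> on primes with \<open>p\<^sup>3 \<le> n\<close>. Inside a shelf \<open>B\<close>
  take a largest set \<open>S\<close> of non-prime-powers with at most \<open>cap p\<close> multiples of each \<open>p\<close>. An
  element of \<open>B\<close> outside \<open>S\<close> is \<open>1\<close>, a prime power, or divisible by a prime that \<open>S\<close> saturates, so
  \<open>B\<close> has at most \<open>1 + (\<Sum>p. 3 - cap p) + |S|\<close> elements. The elements of \<open>S\<close> are products of two
  distinct primes; those with a large factor form a matching of \<open>G(n)\<close>, the others use two left
  vertices each. As neighbourhoods of right vertices are nested, an exchange argument shows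
  that the greedy matching is maximum, so \<open>|S| \<le> |M(n)| + \<lfloor>|F(n)| / 2\<rfloor>\<close>.\<close>

section \<open>Vertices of \<open>G(n)\<close> described by integer inequalities\<close>

lemma left_vertices_iff: "p \<in> left_vertices n \<longleftrightarrow> prime p \<and> n < p ^ 3 \<and> p ^ 2 \<le> n"
proof -
  have "root 3 (real n) < real p \<longleftrightarrow> root 3 (real n) < root 3 (real p ^ 3)"
    by (simp add: real_root_power_cancel)
  also have "\<dots> \<longleftrightarrow> real n < real (p ^ 3)"
    by (subst real_root_less_iff) auto
  also have "\<dots> \<longleftrightarrow> n < p ^ 3"
    by (rule of_nat_less_iff)
  finally have 1: "root 3 (real n) < real p \<longleftrightarrow> n < p ^ 3" .
  have "real p \<le> sqrt (real n) \<longleftrightarrow> sqrt (real p ^ 2) \<le> sqrt (real n)"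
    by simp
  also have "\<dots> \<longleftrightarrow> real (p ^ 2) \<le> real n"
    by (subst real_sqrt_le_iff) auto
  also have "\<dots> \<longleftrightarrow> p ^ 2 \<le> n"
    by (rule of_nat_le_iff)
  finally show ?thesis
    using 1 by (simp add: left_vertices_def primes_between_def)
qed

lemma right_vertices_iff:
  "(q, c) \<in> right_vertices n \<longleftrightarrow> prime q \<and> n < q ^ 2 \<and> q \<le> n \<and> c \<in> {1, 2}"
proof -
  have "sqrt (real n) < real q \<longleftrightarrow> sqrt (real n) < sqrt (real q ^ 2)"
    by simp
  also have "\<dots> \<longleftrightarrow> real n < real (q ^ 2)"
    by (subst real_sqrt_less_iff) auto
  also have "\<dots> \<longleftrightarrow> n < q ^ 2"
    by (rule of_nat_less_iff)
  finally show ?thesis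
    by (auto simp: right_vertices_def primes_between_def)
qed

lemma finite_left_vertices: "finite (left_vertices n)"
proof (rule finite_subset)
  show "left_vertices n \<subseteq> {..n}"
    by (auto simp: left_vertices_iff power2_eq_square intro: order.trans[OF le_square])
qed simp

text \<open>This orients an edge: in a product of a left and a right prime, the smaller factor is
  the left one.\<close>

lemma left_less_right:
  assumes "p \<in> left_vertices n" "(q, c) \<in> right_vertices n"
  shows "p < q"
proof -
  have "p ^ 2 < q ^ 2"
    using assms by (auto simp: left_vertices_iff right_vertices_iff)
  then show ?thesis
    by (rule power_less_imp_less_base) simp
qed

section \<open>The greedy matching is maximum\<close>

definition is_matching :: "nat \<Rightarrow> (nat \<times> nat \<times> nat) set \<Rightarrow> bool" where
  "is_matching n M \<longleftrightarrow> M \<subseteq> edges n \<and> inj_on fst M \<and> inj_on snd M"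

lemma is_matching_iff:
  "is_matching n M \<longleftrightarrow> M \<subseteq> edges n \<and>
     (\<forall>p v p' v'. (p, v) \<in> M \<longrightarrow> (p', v') \<in> M \<longrightarrow> (p = p' \<longleftrightarrow> v = v'))"
  unfolding is_matching_def inj_on_def by (auto 0 3)

lemma finite_edges: "finite (edges n)"
proof (rule finite_subset)
  show "edges n \<subseteq> left_vertices n \<times> right_vertices n"
    by (auto simp: edges_def)
qed (simp add: finite_left_vertices finite_right_vertices)

lemma finite_matching: "is_matching n M \<Longrightarrow> finite M"
  using finite_edges finite_subset by (auto simp: is_matching_def)

lemma fst_next_right_le:
  assumes "v \<in> free_right n M"
  shows "fst (next_right n M) \<le> fst v"
proof -
  have "finite (fst ` free_right n M)"
    by (simp add: free_right_def finite_right_vertices)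
  then show ?thesis
    using assms by (auto simp: next_right_def Let_def)
qed

lemma finite_free_neighbours: "finite (free_neighbours n M)"
  by (simp add: free_neighbours_def finite_left_vertices)

text \<open>Either the greedy edge \<open>(p, v)\<close> touches at most one edge of
  \<open>N\<close>, which it may replace, or \<open>N\<close> contains \<open>(p', v)\<close> and
  \<open>(p, v')\<close>, and these are traded for \<open>(p, v)\<close> and
  \<open>(p', v')\<close>. The trade is legal because greedy takes the largest free neighbour:
  \<open>p' <= p\<close>, so \<open>p'\<close> is adjacent to every right vertex that
  \<open>p\<close> is adjacent to.\<close>

lemma extend_exchange:
  assumes ext: "extendable n M" and N: "is_matching n N" "M \<subseteq> N"
  shows "\<exists>N'. is_matching n N' \<and> extend n M \<subseteq> N' \<and> card N \<le> card N'"
proof -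
  define p where "p = Max (free_neighbours n M)"
  define v where "v = next_right n M"
  have p: "p \<in> free_neighbours n M"
    unfolding p_def using ext finite_free_neighbours by (intro Max_in) (auto simp: extendable_def)
  then have pv: "(p, v) \<in> edges n" and pM: "p \<notin> fst ` M"
    by (auto simp: free_neighbours_def v_def)
  have v: "v \<in> free_right n M"
    unfolding v_def using ext by (intro next_right_in_free_right) (simp add: extendable_def)
  then have vM: "v \<notin> snd ` M"
    by (simp add: free_right_def)
  have finN: "finite N"
    using N finite_matching by blast
  have inj: "\<And>p v p' v'. (p, v) \<in> N \<Longrightarrow> (p', v') \<in> N \<Longrightarrow> p = p' \<longleftrightarrow> v = v'"
    and NE: "N \<subseteq> edges n"
    using N(1) unfolding is_matching_iff by blast+
  \<comment> \<open>Both ends of the greedy edge are free in \<open>M\<close>, so edges of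
    \<open>N\<close> removed at \<open>p\<close> or \<open>v\<close> never belong to
    \<open>M\<close>.\<close>
  have MN': "(x, v) \<notin> M" "(p, w) \<notin> M" for x w
    using pM vM by force+
  show ?thesis
  proof (cases "\<exists>p' v'. (p', v) \<in> N \<and> (p, v') \<in> N")
    case False
    \<comment> \<open>at most one edge of \<open>N\<close> meets the new edge\<close>
    define D where "D = {e \<in> N. fst e = p \<or> snd e = v}"
    have "e = e'" if "e \<in> D" "e' \<in> D" for e e'
    proof -
      have e: "(fst e, snd e) \<in> N" "(fst e', snd e') \<in> N"
        "fst e = p \<or> snd e = v" "fst e' = p \<or> snd e' = v"
        using that by (auto simp: D_def)
      then have "fst e = fst e' \<longleftrightarrow> snd e = snd e'"
        using inj by blast
      then show ?thesis
        using e False by (metis prod.expand)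
    qed
    then have "card D \<le> 1"
      using finN by (intro card_le_Suc0_iff_eq[THEN iffD2, folded One_nat_def]) (auto simp: D_def)
    have "card N = card (N - D) + card D"
      using finN by (simp add: D_def card_Diff_subset card_mono)
    also have "\<dots> \<le> card (insert (p, v) (N - D))"
      using finN \<open>card D \<le> 1\<close> by (subst card_insert_disjoint) (auto simp: D_def)
    finally have "card N \<le> card (insert (p, v) (N - D))" .
    moreover have "is_matching n (insert (p, v) (N - D))"
      using NE pv inj unfolding is_matching_iff by (auto simp: D_def)
    moreover have "extend n M \<subseteq> insert (p, v) (N - D)"
      using N(2) MN' by (auto simp: extend_def p_def[symmetric] v_def[symmetric] D_def)
    ultimately show ?thesis
      by blast
  next
    case True
    then obtain p' v' where p': "(p', v) \<in> N" and v': "(p, v') \<in> N"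
      by blast
    show ?thesis
    proof (cases "p = p'")
      \<comment> \<open>Here the greedy edge already lies in \<open>N\<close>, and \<open>N\<close>
        itself is the witness.\<close>
      case True
      then show ?thesis
        using p' N by (intro exI[of _ N]) (auto simp: extend_def p_def[symmetric] v_def[symmetric])
    next
      case False
      then have vv': "v \<noteq> v'"
        using inj[OF p' v'] by auto
      \<comment> \<open>The only partner of \<open>p'\<close> in \<open>N\<close> is
        \<open>v\<close>, and \<open>v\<close> is free in \<open>M\<close>. So \<open>p'\<close> was
        itself a candidate for \<open>v\<close>, and the choice of the maximum gives
        \<open>p' <= p\<close>.\<close>
      have "p' \<notin> fst ` M"
        using N(2) MN'(1)[of p'] inj[OF p'] by force
      then have "p' \<in> free_neighbours n M"
        using p' NE by (auto simp: free_neighbours_def v_def[symmetric] edges_def)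
      then have "p' \<le> p"
        unfolding p_def using finite_free_neighbours by simp
      have E: "(p', v) \<in> edges n" "(p, v') \<in> edges n"
        using p' v' NE by auto
      have "p' * fst v' \<le> p * fst v'"
        using \<open>p' \<le> p\<close> by simp
      also have "\<dots> \<le> n"
        using E by (simp add: edges_def)
      finally have pE': "(p', v') \<in> edges n"
        using E by (simp add: edges_def)
      define D where "D = {(p', v), (p, v')}"
      define N' where "N' = insert (p, v) (insert (p', v') (N - D))"
      have new: "(p, v) \<notin> N" "(p', v') \<notin> N"
        using inj p' v' False vv' by blast+
      have "card D = 2" "D \<subseteq> N"
        using False p' v' by (auto simp: D_def)
      then have "card N' = card N"
        using finN new False card_mono[of N D]
        by (simp add: N'_def card_insert_if card_Diff_subset finite_subset)
      moreover have "is_matching n N'"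
        unfolding is_matching_iff
      proof (intro conjI allI impI)
        show "N' \<subseteq> edges n"
          using NE pv pE' by (auto simp: N'_def)
      next
        \<comment> \<open>Every edge of \<open>N'\<close> is one of the two new ones or an old edge
          avoiding all four ends, so no end is shared.\<close>
        have mem: "x = p \<and> w = v \<or> x = p' \<and> w = v' \<or> (x, w) \<in> N \<and> x \<noteq> p \<and> x \<noteq> p' \<and> w \<noteq> v \<and> w \<noteq> v'"
          if "(x, w) \<in> N'" for x w
          using that inj[OF p', of x w] inj[OF v', of x w] unfolding N'_def D_def by auto
        fix x w x' w' assume xw: "(x, w) \<in> N'" "(x', w') \<in> N'"
        show "x = x' \<longleftrightarrow> w = w'"
          using mem[OF xw(1)] mem[OF xw(2)] inj[of x w x' w'] False vv' by metis
      qed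
      moreover have "extend n M \<subseteq> N'"
        using N(2) MN' by (auto simp: extend_def p_def[symmetric] v_def[symmetric] N'_def D_def)
      ultimately show ?thesis
        by (metis order_refl)
    qed
  qed
qed

text \<open>The exchange applied to \<open>N = M\<close> puts \<open>extend n M\<close> inside some
  matching, and subsets of matchings are matchings.\<close>

lemma is_matching_extend:
  assumes "is_matching n M" "extendable n M"
  shows "is_matching n (extend n M)"
  using extend_exchange[OF assms(2,1)] unfolding is_matching_def
  by (meson inj_on_subset order.trans order_refl)

text \<open>The loop inspects only the smallest free right prime. That is enough: if
  \<open>N\<close> had a further edge \<open>(p, v)\<close>, then \<open>p\<close> would also be
  adjacent to this smaller prime, and the loop could have continued.\<close>

lemma not_extendable_maximal:
  assumes "\<not> extendable n M" "is_matching n N" "M \<subseteq> N"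
  shows "N = M"
proof (rule ccontr)
  assume "N \<noteq> M"
  then obtain p v where pv: "(p, v) \<in> N" "(p, v) \<notin> M"
    using assms(3) by auto
  have inj: "\<And>p v p' v'. (p, v) \<in> N \<Longrightarrow> (p', v') \<in> N \<Longrightarrow> p = p' \<longleftrightarrow> v = v'"
    and E: "(p, v) \<in> edges n"
    using assms(2) pv(1) unfolding is_matching_iff by blast+
  have p: "p \<notin> fst ` M" and "v \<notin> snd ` M"
    using pv assms(3) inj by (auto, blast+)
  then have v: "v \<in> free_right n M"
    using E by (auto simp: free_right_def edges_def)
  have "p * fst (next_right n M) \<le> p * fst v"
    using fst_next_right_le[OF v] by simp
  also have "\<dots> \<le> n"
    using E by (simp add: edges_def)
  finally have "p * fst (next_right n M) \<le> n" .
  moreover have "next_right n M \<in> right_vertices n"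
    using next_right_in_free_right[of n M] v by (auto simp: free_right_def)
  ultimately have "p \<in> free_neighbours n M"
    using E p by (auto simp: free_neighbours_def edges_def)
  then show False
    using assms(1) v by (auto simp: extendable_def)
qed

text \<open>Loop invariant: every matching can be exchanged, without losing edges, for one that
  contains the current \<open>M\<close>. When the loop stops, the only matching containing
  \<open>M\<close> is \<open>M\<close> itself, so no matching is larger.\<close>

lemma greedy_matching_maximum:
  shows is_matching_greedy: "is_matching n (greedy_matching n)"
    and card_matching_le_greedy: "is_matching n N \<Longrightarrow> card N \<le> card (greedy_matching n)"
proof -
  define P where "P M \<longleftrightarrow> is_matching n M \<and>
    (\<forall>N. is_matching n N \<longrightarrow> (\<exists>N'. is_matching n N' \<and> M \<subseteq> N' \<and> card N \<le> card N'))" for M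
  have "P (greedy_matching n)"
  proof (rule while_option_rule[OF _ greedy_matching_terminates])
    fix M assume M: "P M" "extendable n M"
    then show "P (extend n M)"
      unfolding P_def using is_matching_extend extend_exchange by (meson order.trans)
  next
    show "P {}"
      by (auto simp: P_def is_matching_def)
  qed
  moreover have "\<not> extendable n (greedy_matching n)"
    using while_option_stop[OF greedy_matching_terminates] .
  ultimately show "is_matching n (greedy_matching n)"
    and "is_matching n N \<Longrightarrow> card N \<le> card (greedy_matching n)"
    unfolding P_def using not_extendable_maximal by blast+
qed

section \<open>Upper bound\<close>

text \<open>The quantity \<open>cap p\<close> of the overview is written
  \<open>3 - card (powers n p)\<close> from here on. The subtraction is never truncated, by
  \<open>card_powers_le\<close>.\<close>

definition powers :: "nat \<Rightarrow> nat \<Rightarrow> nat set" where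
  "powers n p = {p ^ i | i. i \<in> {1, 2, 3} \<and> p ^ i \<le> n}"

lemma finite_powers: "finite (powers n p)"
  by (rule finite_subset[of _ "{..n}"]) (auto simp: powers_def)

lemma powers_eq_image: "powers n p = (\<lambda>i. p ^ i) ` {i \<in> {1, 2, 3}. p ^ i \<le> n}"
  by (auto simp: powers_def)

lemma card_powers:
  assumes "p \<ge> 2"
  shows "card (powers n p) = card {i \<in> {1, 2, 3}. p ^ i \<le> n}"
  unfolding powers_eq_image using assms by (intro card_image) (auto simp: inj_on_def)

lemma card_powers_le: "card (powers n p) \<le> 3"
proof -
  have "card (powers n p) \<le> card {i \<in> {1, 2, 3::nat}. p ^ i \<le> n}"
    unfolding powers_eq_image by (rule card_image_le) simp
  also have "\<dots> \<le> card {1, 2, 3::nat}"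
    by (intro card_mono) auto
  finally show ?thesis
    by simp
qed

lemma card_powers_small:
  assumes "prime p" "p ^ 3 \<le> n"
  shows "card (powers n p) = 3"
proof -
  have "p ^ i \<le> n" if "i \<le> 3" for i
    using assms that by (meson order.trans power_increasing prime_ge_1_nat)
  from this[of 1] this[of 2] this[of 3] have "{i \<in> {1, 2, 3::nat}. p ^ i \<le> n} = {1, 2, 3}"
    by auto
  then show ?thesis
    using assms by (simp add: card_powers prime_ge_2_nat)
qed

lemma card_powers_left:
  assumes "p \<in> left_vertices n"
  shows "card (powers n p) = 2"
proof -
  have "p \<le> p ^ 2"
    by (simp add: power2_eq_square)
  then have "{i \<in> {1, 2, 3::nat}. p ^ i \<le> n} = {1, 2}"
    using assms unfolding left_vertices_iff by auto
  then show ?thesis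
    using assms by (simp add: card_powers prime_ge_2_nat left_vertices_iff)
qed

lemma card_powers_right:
  assumes "(q, c) \<in> right_vertices n"
  shows "card (powers n q) = 1"
proof -
  have "q ^ 2 \<le> q ^ 3"
    using assms by (intro power_increasing) (auto simp: right_vertices_iff Suc_le_eq prime_gt_0_nat)
  then have "{i \<in> {1, 2, 3::nat}. q ^ i \<le> n} = {1}"
    using assms unfolding right_vertices_iff by auto
  then show ?thesis
    using assms by (simp add: card_powers prime_ge_2_nat right_vertices_iff)
qed

text \<open>\<open>S\<close> is chosen of maximum size, so an element left out that is neither 1 nor
  a prime power must be a multiple of a saturated prime \<open>p\<close>. At most
  \<open>3 - (3 - card (powers n p))\<close> multiples of such a \<open>p\<close> remain in
  \<open>B - S\<close>, which is just the number of powers of \<open>p\<close>.\<close>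

lemma shelf_saturating_subset:
  assumes B: "shelf n 3 B"
  obtains S where "S \<subseteq> B" "\<And>b p i. b \<in> S \<Longrightarrow> prime p \<Longrightarrow> b \<noteq> p ^ i"
    "\<And>p. prime p \<Longrightarrow> num_multiples p S \<le> 3 - card (powers n p)"
    "card B \<le> 1 + (\<Sum>p | prime p \<and> p \<le> n. card (powers n p)) + card S"
proof -
  have Bn: "B \<subseteq> {1..n}" and deg: "\<And>p. prime p \<Longrightarrow> num_multiples p B \<le> 3"
    using B by (auto simp: shelf_def)
  then have finB: "finite B"
    using finite_subset by blast
  define good where "good S \<longleftrightarrow> S \<subseteq> B \<and> (\<forall>b\<in>S. \<forall>p i. prime p \<longrightarrow> b \<noteq> p ^ i) \<and>
    (\<forall>p. prime p \<longrightarrow> num_multiples p S \<le> 3 - card (powers n p))" for S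
  have "good {}"
    by (simp add: good_def num_multiples_def)
  moreover have "\<forall>S. good S \<longrightarrow> card S < card B + 1"
    using finB by (auto simp: good_def less_Suc_eq_le card_mono)
  ultimately obtain S where S: "good S" and max: "\<And>T. good T \<Longrightarrow> card T \<le> card S"
    using ex_has_greatest_nat[of good "{}" card "card B + 1"] by blast
  have SB: "S \<subseteq> B" and S_pp: "\<And>b p i. b \<in> S \<Longrightarrow> prime p \<Longrightarrow> b \<noteq> p ^ i"
    and cap: "\<And>p. prime p \<Longrightarrow> num_multiples p S \<le> 3 - card (powers n p)"
    using S unfolding good_def by blast+
  have finS: "finite S"
    using SB finB finite_subset by blast
  define sat where "sat p \<longleftrightarrow> num_multiples p S = 3 - card (powers n p)" for p
  \<comment> \<open>\<open>W p\<close> contains the elements charged to \<open>p\<close>: all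
    remaining multiples if \<open>p\<close> is saturated, otherwise the powers of \<open>p\<close>.
    Either way there are at most \<open>card (powers n p)\<close> of them.\<close>
  define W where "W p = (if sat p then {b \<in> B - S. p dvd b} else powers n p)" for p
  have cardW: "card (W p) \<le> card (powers n p)" if "prime p" for p
  proof (cases "sat p")
    case True
    have "{b \<in> B. p dvd b} = {b \<in> B - S. p dvd b} \<union> {b \<in> S. p dvd b}"
      using SB by auto
    then have "num_multiples p B = card ({b \<in> B - S. p dvd b} \<union> {b \<in> S. p dvd b})"
      by (simp add: num_multiples_def)
    also have "\<dots> = card (W p) + num_multiples p S"
      unfolding num_multiples_def using True finB finS
      by (subst card_Un_disjoint) (auto simp: W_def)
    finally show ?thesis
      using True deg[OF that] card_powers_le[of n p] by (simp add: sat_def)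
  qed (simp add: W_def)
  have cover: "B \<subseteq> insert 1 S \<union> (\<Union>p\<in>{p. prime p \<and> p \<le> n}. W p)"
  proof
    fix b assume b: "b \<in> B"
    then have bn: "1 \<le> b" "b \<le> n"
      using Bn by auto
    have le_n: "p \<le> n" if "p dvd b" for p
      using dvd_imp_le[OF that] bn by simp
    show "b \<in> insert 1 S \<union> (\<Union>p\<in>{p. prime p \<and> p \<le> n}. W p)"
    proof (cases "b = 1 \<or> b \<in> S")
      case False
      show ?thesis
      proof (cases "\<exists>p i. prime p \<and> b = p ^ i")
        case True
        then obtain p i where pi: "prime p" "b = p ^ i"
          by blast
        then have "i \<noteq> 0"
          using False by (metis power_0)
        then have pb: "p dvd b"
          using pi by (simp add: dvd_power)
        have "b \<in> W p"
        proof (cases "sat p")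
          case True
          then show ?thesis
            using b False pb by (simp add: W_def)
        next
          case nsat: False
          \<comment> \<open>If \<open>p ^ 3 <= n\<close>, then \<open>p\<close> has capacity 0 and
            is saturated by any admissible \<open>S\<close>; an unsaturated prime therefore has only
            exponents below 3 to account for.\<close>
          have "\<not> 3 \<le> i"
          proof
            assume "3 \<le> i"
            then have "p ^ 3 \<le> n"
              using pi bn by (meson order.trans power_increasing prime_ge_1_nat)
            then show False
              using nsat cap[OF pi(1)] card_powers_small[OF pi(1)] by (simp add: sat_def)
          qed
          then have "i \<in> {1, 2, 3}"
            using \<open>i \<noteq> 0\<close> by auto
          then show ?thesis
            using nsat pi bn by (auto simp: W_def powers_def)
        qed
        then show ?thesis
          using pi pb le_n by blast
      next
        case npp: False
        \<comment> \<open>By maximality, adding \<open>b\<close> breaks the capacity of some prime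
          \<open>p\<close>. The count changes only at divisors of \<open>b\<close>, and by 1, so
          \<open>p\<close> divides \<open>b\<close> and was already saturated.\<close>
        have "\<not> good (insert b S)"
          using max[of "insert b S"] False finS by auto
        then obtain p where p: "prime p" "\<not> num_multiples p (insert b S) \<le> 3 - card (powers n p)"
          using npp b SB S_pp unfolding good_def by blast
        have "{x \<in> insert b S. p dvd x} =
            (if p dvd b then insert b {x \<in> S. p dvd x} else {x \<in> S. p dvd x})"
          by auto
        then have "num_multiples p (insert b S) = num_multiples p S + (if p dvd b then 1 else 0)"
          using False finS by (simp add: num_multiples_def)
        then have "p dvd b" "sat p"
          using p(2) cap[OF p(1)] by (auto simp: sat_def split: if_splits)
        then have "b \<in> W p"
          using b False by (simp add: W_def)
        then show ?thesis
          using p(1) \<open>p dvd b\<close> le_n by blast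
      qed
    qed auto
  qed
  have finW: "finite (W p)" for p
    using finB by (simp add: W_def finite_powers)
  have "card B \<le> card (insert 1 S \<union> (\<Union>p\<in>{p. prime p \<and> p \<le> n}. W p))"
    using finS finW by (intro card_mono[OF _ cover]) auto
  also have "\<dots> \<le> card (insert 1 S) + card (\<Union>p\<in>{p. prime p \<and> p \<le> n}. W p)"
    by (rule card_Un_le)
  also have "\<dots> \<le> (1 + card S) + (\<Sum>p | prime p \<and> p \<le> n. card (W p))"
    using finS by (intro add_mono card_UN_le) (auto simp: card_insert_if)
  also have "\<dots> \<le> (1 + card S) + (\<Sum>p | prime p \<and> p \<le> n. card (powers n p))"
    using cardW by (intro add_left_mono sum_mono) simp
  finally show ?thesis
    using that[OF SB S_pp cap] by simp
qed

text \<open>Among three prime factors the smallest would have its cube at most \<open>b\<close>,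
  hence at most \<open>n\<close>. So \<open>b\<close> has exactly two prime factors, and the smaller
  one has its square at most \<open>b\<close>.\<close>

lemma two_large_primes:
  assumes "1 \<le> b" "b \<le> n" and large: "\<And>p. prime p \<Longrightarrow> p dvd b \<Longrightarrow> n < p ^ 3"
    and npp: "\<And>p i. prime p \<Longrightarrow> b \<noteq> p ^ i"
  obtains p q where "prime p" "prime q" "p < q" "b = p * q" "p \<in> left_vertices n"
proof -
  \<comment> \<open>The assumption \<open>npp\<close> is used with exponents 0, 1 and 2 in turn,
    excluding \<open>b = 1\<close>, a prime \<open>b\<close> and the square of a prime.\<close>
  have "b \<noteq> 1"
    using npp[of 2 0] by simp
  then obtain p where p: "prime p" "p dvd b"
    using prime_factor_nat by blast
  then obtain m where m: "b = p * m"
    by blast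
  have "m \<noteq> 1"
    using npp[OF p(1), of 1] m by auto
  then obtain q where q: "prime q" "q dvd m"
    using prime_factor_nat by blast
  then obtain r where r: "b = p * q * r"
    using m by (auto simp: mult.assoc)
  have "r = 1"
  proof (rule ccontr)
    assume "r \<noteq> 1"
    then obtain t where t: "prime t" "t dvd r"
      using prime_factor_nat by blast
    define x where "x = Min {p, q, t}"
    have "x ^ 3 = x * x * x"
      by (simp add: power3_eq_cube)
    also have "\<dots> \<le> p * q * t"
      by (intro mult_mono) (auto simp: x_def)
    also have "\<dots> \<le> b"
      using r t(2) assms(1) by (intro dvd_imp_le) auto
    finally have "x ^ 3 \<le> n"
      using assms(2) by simp
    moreover have "x \<in> {p, q, t}"
      unfolding x_def by (rule Min_in) auto
    then have "prime x \<and> x dvd b"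
      using p q t r by auto
    ultimately show False
      using large[of x] by simp
  qed
  then have b: "b = p * q"
    using r by simp
  then have "p \<noteq> q"
    using npp[OF p(1), of 2] by (auto simp: power2_eq_square)
  have *: "u \<in> left_vertices n" if "prime u" "u < v" "b = u * v" for u v
  proof -
    have "u ^ 2 \<le> b"
      using that by (simp add: power2_eq_square)
    then show ?thesis
      using that large[of u] assms(2) by (simp add: left_vertices_iff)
  qed
  show ?thesis
  proof (cases "p < q")
    case True
    then show ?thesis
      using that[of p q] p q b * by blast
  next
    case False
    then have "q < p" "b = q * p"
      using \<open>p \<noteq> q\<close> b by (auto simp: mult.commute)
    then show ?thesis
      using that[of q p] p q * by blast
  qed
qed

section \<open>Bounding capacity-respecting sets of products by the greedy matching\<close>

lemma prime_mult_eq_iff: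
  assumes "prime p" "prime q" "prime p'" "prime q'"
  shows "p * q = p' * q' \<longleftrightarrow> p = p' \<and> q = q' \<or> p = q' \<and> q = (p' :: nat)"
proof
  assume eq: "p * q = p' * q'"
  have "p dvd p' * q'"
    using eq by (metis dvd_triv_left)
  then consider "p = p'" | "p = q'"
    using assms by (auto simp: prime_dvd_mult_iff primes_dvd_imp_eq)
  then show "p = p' \<and> q = q' \<or> p = q' \<and> q = p'"
    using eq assms(1) by cases auto
qed auto

lemma prime_dvd_prime_mult:
  assumes "prime p" "prime q" "prime (r :: nat)"
  shows "r dvd p * q \<longleftrightarrow> r = p \<or> r = q"
  using assms by (auto simp: prime_dvd_mult_iff primes_dvd_imp_eq)

lemma num_multiples_leD:
  assumes "num_multiples p S \<le> k" "finite S" "X \<subseteq> S" "\<And>x. x \<in> X \<Longrightarrow> p dvd x"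
  shows "card X \<le> k"
proof -
  have "card X \<le> num_multiples p S"
    unfolding num_multiples_def using assms by (intro card_mono) auto
  then show ?thesis
    using assms(1) by simp
qed

text \<open>The products are read as edges of a matching \<open>N\<close>: capacity 1 gives each
  left prime a single edge, and capacity 2 lets the partners of a right prime occupy different
  copies. Multiplying the ends of the edges recovers all of \<open>S\<close>.\<close>

lemma card_le_matching:
  assumes fin: "finite S"
    and capL: "\<And>p. p \<in> left_vertices n \<Longrightarrow> num_multiples p S \<le> 1"
    and capR: "\<And>q c. (q, c) \<in> right_vertices n \<Longrightarrow> num_multiples q S \<le> 2"
    and S: "\<And>b. b \<in> S \<Longrightarrow> b \<le> n \<and> (\<exists>p q c. b = p * q \<and> p \<in> left_vertices n \<and> (q, c) \<in> right_vertices n)"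
  shows "card S \<le> card (greedy_matching n)"
proof -
  \<comment> \<open>of the at most two partners of \<open>q\<close>, the smaller one gets the first copy\<close>
  define copy :: "nat \<Rightarrow> nat \<Rightarrow> nat" where "copy p q = (if \<exists>p'<p. p' \<in> left_vertices n \<and> p' * q \<in> S then 2 else 1)" for p q
  define N where "N = {(p, (q, copy p q)) | p q. p \<in> left_vertices n \<and> (q, 1) \<in> right_vertices n \<and> p * q \<in> S}"
  have primeL: "prime p" if "p \<in> left_vertices n" for p
    using that by (simp add: left_vertices_iff)
  have "is_matching n N"
    unfolding is_matching_iff
  proof (intro conjI allI impI)
    show "N \<subseteq> edges n"
      using S by (auto simp: N_def edges_def copy_def right_vertices_iff)
  next
    fix p v p' v' assume "(p, v) \<in> N" "(p', v') \<in> N"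
    then obtain q q' where
      pq: "p \<in> left_vertices n" "(q, 1) \<in> right_vertices n" "p * q \<in> S" "v = (q, copy p q)" and
      pq': "p' \<in> left_vertices n" "(q', 1) \<in> right_vertices n" "p' * q' \<in> S" "v' = (q', copy p' q')"
      unfolding N_def by blast
    have pr: "prime p" "prime p'" "prime q"
      using pq pq' by (auto simp: left_vertices_iff right_vertices_iff)
    show "p = p' \<longleftrightarrow> v = v'"
    proof
      assume eq: "p = p'"
      have "card {p * q, p * q'} \<le> 1"
        using pq pq' eq by (intro num_multiples_leD[OF capL[OF pq(1)] fin]) auto
      then have "p * q = p * q'"
        by (cases "p * q = p * q'") auto
      then show "v = v'"
        using eq pq pq' pr by auto
    next
      assume eq: "v = v'"
      \<comment> \<open>The partner \<open>u\<close> forces copy 2 on the larger \<open>w\<close>.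
        If \<open>u\<close> had copy 2 as well, a still smaller partner \<open>t\<close> would
        exist, and \<open>q\<close> would have three multiples in \<open>S\<close>.\<close>
      have *: False if "u < w" "u \<in> left_vertices n" "w \<in> left_vertices n" "u * q \<in> S" "w * q \<in> S"
        "copy u q = copy w q" for u w
      proof -
        have "copy u q = 2"
          using that by (auto simp: copy_def)
        then obtain t where t: "t < u" "t * q \<in> S"
          by (auto simp: copy_def split: if_splits)
        have "card {t * q, u * q, w * q} \<le> 2"
          using that t by (intro num_multiples_leD[OF capR[OF pq(2)] fin]) auto
        moreover have "t * q \<noteq> u * q" "t * q \<noteq> w * q" "u * q \<noteq> w * q"
          using that t pr by auto
        ultimately show False
          by simp
      qed
      show "p = p'"
        using *[of p p'] *[of p' p] eq pq pq' by (cases p p' rule: linorder_cases) auto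
    qed
  qed
  moreover have "card S \<le> card N"
  proof (rule surj_card_le)
    show "finite N"
      using \<open>is_matching n N\<close> by (rule finite_matching)
    show "S \<subseteq> (\<lambda>(p, v). p * fst v) ` N"
    proof
      fix b assume b: "b \<in> S"
      then obtain p q c where pq: "b = p * q" "p \<in> left_vertices n" "(q, c) \<in> right_vertices n"
        using S by blast
      then have "(p, (q, copy p q)) \<in> N"
        using b by (auto simp: N_def right_vertices_iff)
      then show "b \<in> (\<lambda>(p, v). p * fst v) ` N"
        using pq by force
    qed
  qed
  ultimately show ?thesis
    using card_matching_le_greedy by (meson order.trans)
qed

lemma card_unmatched_left:
  "card (unmatched_left n) + card (greedy_matching n) = card (left_vertices n)"
proof -
  have M: "is_matching n (greedy_matching n)"
    by (rule is_matching_greedy)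
  then have "fst ` greedy_matching n \<subseteq> left_vertices n"
    by (auto simp: is_matching_def edges_def)
  moreover have "card (fst ` greedy_matching n) = card (greedy_matching n)"
    using M by (intro card_image) (simp add: is_matching_def)
  ultimately show ?thesis
    unfolding unmatched_left_def
    using finite_left_vertices[of n] card_mono[of "left_vertices n" "fst ` greedy_matching n"]
    by (simp add: card_Diff_subset finite_subset)
qed

text \<open>Let \<open>SR\<close> be the elements of \<open>S\<close> with a right prime factor.
  They number at most \<open>|M(n)|\<close>. Each consumes at least one left prime, each other
  element consumes two, and every left prime is consumed at most once.\<close>

lemma card_saturating_le:
  assumes Sn: "S \<subseteq> {1..n}" and npp: "\<And>b p i. b \<in> S \<Longrightarrow> prime p \<Longrightarrow> b \<noteq> p ^ i"
    and cap: "\<And>p. prime p \<Longrightarrow> num_multiples p S \<le> 3 - card (powers n p)"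
  shows "card S \<le> card (greedy_matching n) + card (unmatched_left n) div 2"
proof -
  have fin: "finite S"
    using Sn finite_subset by blast
  have capL: "num_multiples p S \<le> 1" if "p \<in> left_vertices n" for p
    using cap[of p] card_powers_left[OF that] that by (simp add: left_vertices_iff)
  have capR: "num_multiples q S \<le> 2" if "(q, c) \<in> right_vertices n" for q c
    using cap[of q] card_powers_right[OF that] that by (simp add: right_vertices_iff)
  \<comment> \<open>A prime with \<open>p ^ 3 <= n\<close> has capacity 0, so it divides no element
    of \<open>S\<close>.\<close>
  have large: "n < p ^ 3" if "prime p" "p dvd b" "b \<in> S" for p b
  proof (rule ccontr)
    assume "\<not> n < p ^ 3"
    then have "num_multiples p S \<le> 0"
      using cap[OF that(1)] card_powers_small[of p n] that by simp
    then have "card {b} \<le> 0"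
      using that fin by (intro num_multiples_leD) auto
    then show False
      by simp
  qed
  define SR where "SR = {b \<in> S. \<exists>p q c. b = p * q \<and> p \<in> left_vertices n \<and> (q, c) \<in> right_vertices n}"
  have "card SR \<le> card (greedy_matching n)"
  proof (rule card_le_matching)
    have mono: "num_multiples p SR \<le> num_multiples p S" for p
      unfolding num_multiples_def using fin by (intro card_mono) (auto simp: SR_def)
    show "num_multiples p SR \<le> 1" if "p \<in> left_vertices n" for p
      using capL[OF that] mono[of p] by simp
    show "num_multiples q SR \<le> 2" if "(q, c) \<in> right_vertices n" for q c
      using capR[OF that] mono[of q] by simp
    show "finite SR"
      using fin by (simp add: SR_def)
    show "b \<le> n \<and> (\<exists>p q c. b = p * q \<and> p \<in> left_vertices n \<and> (q, c) \<in> right_vertices n)"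
      if "b \<in> SR" for b
      using that Sn unfolding SR_def by auto
  qed
  have factors: "\<exists>p q. prime p \<and> prime q \<and> p < q \<and> b = p * q \<and> p \<in> left_vertices n \<and> q \<le> n"
    if bS: "b \<in> S" for b
  proof -
    have b: "1 \<le> b" "b \<le> n"
      using bS Sn by auto
    obtain p q where pq: "prime p" "prime q" "p < q" "b = p * q" "p \<in> left_vertices n"
      using two_large_primes[OF b large[OF _ _ bS] npp[OF bS]] by blast
    then have "q \<le> n"
      using b by (intro dvd_imp_le[of q b, THEN order.trans]) auto
    then show ?thesis
      using pq by blast
  qed
  \<comment> \<open>Double counting of the pairs of a left prime and a multiple of it in
    \<open>S\<close>.\<close>
  have sumL: "(\<Sum>p\<in>left_vertices n. num_multiples p S) = (\<Sum>b\<in>S. card {p \<in> left_vertices n. p dvd b})"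
    unfolding num_multiples_def using fin finite_left_vertices
    by (simp add: sum_multicount_gen[of "left_vertices n" S "\<lambda>p b. p dvd b" "\<lambda>b. card {p \<in> left_vertices n. p dvd b}"])
  have ge1: "1 \<le> card {p \<in> left_vertices n. p dvd b}" if b: "b \<in> S" for b
  proof -
    obtain p where "p \<in> left_vertices n" "p dvd b"
      using factors[OF b] by auto
    then have "card {p} \<le> card {p \<in> left_vertices n. p dvd b}"
      using finite_left_vertices by (intro card_mono) auto
    then show ?thesis
      by simp
  qed
  have ge2: "2 \<le> card {p \<in> left_vertices n. p dvd b}" if b: "b \<in> S - SR" for b
  proof -
    obtain p q where pq: "prime p" "prime q" "p < q" "b = p * q" "p \<in> left_vertices n" "q \<le> n"
      using factors b by blast
    \<comment> \<open>A right prime \<open>q\<close> would put \<open>b\<close> into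
      \<open>SR\<close>. Since \<open>q <= n < q ^ 3\<close>, the only other possibility is that
      \<open>q\<close> is a left prime.\<close>
    have "(q, 1) \<notin> right_vertices n"
      using b pq by (auto simp: SR_def)
    then have "q \<in> left_vertices n"
      using pq large[of q b] b by (auto simp: left_vertices_iff right_vertices_iff)
    then have "card {p, q} \<le> card {p \<in> left_vertices n. p dvd b}"
      using finite_left_vertices pq by (intro card_mono) auto
    then show ?thesis
      using pq by simp
  qed
  have SRS: "SR \<subseteq> S"
    by (auto simp: SR_def)
  have "card SR + 2 * card (S - SR) = (\<Sum>b\<in>SR. 1) + (\<Sum>b\<in>S - SR. 2)"
    by simp
  also have "\<dots> \<le> (\<Sum>b\<in>SR. card {p \<in> left_vertices n. p dvd b})
      + (\<Sum>b\<in>S - SR. card {p \<in> left_vertices n. p dvd b})"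
    using ge1 ge2 SRS by (intro add_mono sum_mono) auto
  also have "\<dots> = (\<Sum>b\<in>S. card {p \<in> left_vertices n. p dvd b})"
    by (simp add: sum.subset_diff[OF SRS fin])
  also have "\<dots> \<le> (\<Sum>p\<in>left_vertices n. 1)"
    unfolding sumL[symmetric] using capL by (intro sum_mono)
  finally have "card SR + 2 * card (S - SR) \<le> card (left_vertices n)"
    by simp
  moreover have "card S = card SR + card (S - SR)"
    using SRS fin by (simp add: card_Diff_subset card_mono finite_subset)
  \<comment> \<open>Adding the bound on \<open>SR\<close> to the double count gives
    \<open>2 * |S| <= 2 * |M(n)| + |F(n)|\<close>.\<close>
  ultimately show ?thesis
    using \<open>card SR \<le> card (greedy_matching n)\<close> card_unmatched_left[of n] by linarith
qed

section \<open>The extremal set\<close>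

definition matched_products :: "nat \<Rightarrow> nat set" where
  "matched_products n = {p * q | p q c. (p, q, c) \<in> greedy_matching n}"

definition paired_products :: "nat \<Rightarrow> (nat \<Rightarrow> nat) \<Rightarrow> nat set" where
  "paired_products s a = {a (2 * i - 1) * a (2 * i) | i. i \<in> {1..s div 2}}"

definition prime_powers :: "nat \<Rightarrow> nat set" where
  "prime_powers n = {p ^ i | p i. prime p \<and> i \<in> {1, 2, 3} \<and> p ^ i \<le> n}"

lemma prime_powers_eq_Union: "prime_powers n = (\<Union>p\<in>{p. prime p \<and> p \<le> n}. powers n p)"
proof -
  have "p \<le> n" if "prime p" "p ^ i \<le> n" "i \<in> {1, 2, 3}" for p i
    using that self_le_power[of p i] prime_ge_1_nat[of p] by auto
  then show ?thesis
    unfolding prime_powers_def powers_def by blast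
qed

lemma card_prime_powers: "card (prime_powers n) = (\<Sum>p | prime p \<and> p \<le> n. card (powers n p))"
  unfolding prime_powers_eq_Union
proof (rule card_UN_disjoint)
  show "\<forall>p\<in>{p. prime p \<and> p \<le> n}. \<forall>q\<in>{p. prime p \<and> p \<le> n}. p \<noteq> q \<longrightarrow> powers n p \<inter> powers n q = {}"
  proof (intro ballI impI)
    fix p q assume pq: "p \<in> {p. prime p \<and> p \<le> n}" "q \<in> {p. prime p \<and> p \<le> n}" "p \<noteq> q"
    have neq: "p ^ i \<noteq> q ^ j" if "i \<in> {1, 2, 3}" for i j :: nat
    proof
      assume "p ^ i = q ^ j"
      moreover have "p dvd p ^ i"
        using that by (intro dvd_power) auto
      ultimately have "p dvd q ^ j"
        by simp
      then show False
        using pq prime_dvd_power[of p q j] primes_dvd_imp_eq[of p q] by auto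
    qed
    show "powers n p \<inter> powers n q = {}"
    proof (intro equals0I)
      fix x assume "x \<in> powers n p \<inter> powers n q"
      then obtain i j where "i \<in> {1, 2, 3}" "x = p ^ i" "x = q ^ j"
        unfolding powers_def by blast
      then show False
        using neq by metis
    qed
  qed
qed (auto simp: finite_powers)

lemma prime_mult_neq_prime_power:
  assumes "prime p" "prime q" "p \<noteq> q" "prime r"
  shows "p * q \<noteq> r ^ i"
proof
  assume eq: "p * q = r ^ i"
  have "p dvd r ^ i" "q dvd r ^ i"
    unfolding eq[symmetric] by auto
  then have "p dvd r" "q dvd r"
    using assms by (auto dest: prime_dvd_power)
  then show False
    using assms by (metis primes_dvd_imp_eq)
qed

lemma greedy_edge:
  assumes "(p, v) \<in> greedy_matching n"
  shows "p \<in> left_vertices n" "v \<in> right_vertices n" "p * fst v \<le> n"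
  using assms is_matching_greedy[of n] by (auto simp: is_matching_def edges_def)

lemma matched_products_eq_image:
  "matched_products n = (\<lambda>(p, v). p * fst v) ` greedy_matching n"
  unfolding matched_products_def by (force simp: image_iff)

lemma finite_greedy_matching: "finite (greedy_matching n)"
  by (rule finite_matching[OF is_matching_greedy])

text \<open>A product determines its left factor, the smaller one, and a left vertex lies on only
  one edge. Hence edges at the two copies of one prime also give different products.\<close>

lemma card_matched_products: "card (matched_products n) = card (greedy_matching n)"
  unfolding matched_products_eq_image
proof (rule card_image, rule inj_onI)
  fix e e' assume e: "e \<in> greedy_matching n" "e' \<in> greedy_matching n"
    and eq: "(case e of (p, v) \<Rightarrow> p * fst v) = (case e' of (p, v) \<Rightarrow> p * fst v)"
  obtain p q c p' q' c' where [simp]: "e = (p, q, c)" "e' = (p', q', c')"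
    by (metis prod.exhaust)
  have L: "p \<in> left_vertices n" "p' \<in> left_vertices n" "(q, c) \<in> right_vertices n" "(q', c') \<in> right_vertices n"
    using greedy_edge e by auto
  then have "p = p'"
    using eq left_less_right[OF L(1,4)] left_less_right[OF L(2,4)] prime_mult_eq_iff[of p q p' q']
    by (auto simp: left_vertices_iff right_vertices_iff)
  moreover have "inj_on fst (greedy_matching n)"
    using is_matching_greedy[of n] by (simp add: is_matching_def)
  ultimately show "e = e'"
    using inj_onD[of fst "greedy_matching n" e e'] e by simp
qed

section \<open>Products along an enumeration of \<open>F(n)\<close>\<close>

context
  fixes n s :: nat and a :: "nat \<Rightarrow> nat"
  assumes a: "bij_betw a {1..s} (unmatched_left n)"
begin

lemma unmatched_index:
  assumes "i \<in> {1..s}"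
  shows "a i \<in> left_vertices n" "a i \<notin> fst ` greedy_matching n" "prime (a i)"
  using bij_betwE[OF a] assms by (auto simp: unmatched_left_def left_vertices_iff)

lemma index_eq_iff: "i \<in> {1..s} \<Longrightarrow> j \<in> {1..s} \<Longrightarrow> a i = a j \<longleftrightarrow> i = j"
  using bij_betw_imp_inj_on[OF a] by (rule inj_on_eq_iff)

lemma pair_indices:
  assumes "i \<in> {1..s div 2}"
  shows "2 * i - 1 \<in> {1..s}" "2 * i \<in> {1..s}" "2 * i - 1 \<noteq> 2 * i"
  using assms by auto

text \<open>The enumeration is injective, so a shared prime means a shared index, and the index
  pairs \<open>2 * i - 1, 2 * i\<close> do not overlap.\<close>

lemma pair_disjoint:
  assumes "i \<in> {1..s div 2}" "j \<in> {1..s div 2}"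
    and "r \<in> {a (2 * i - 1), a (2 * i)}" "r \<in> {a (2 * j - 1), a (2 * j)}"
  shows "i = j"
proof -
  obtain k l where kl: "k \<in> {2 * i - 1, 2 * i}" "l \<in> {2 * j - 1, 2 * j}" "a k = a l"
    using assms(3,4) by blast
  then have "k \<in> {1..s}" "l \<in> {1..s}"
    using pair_indices(1,2)[OF assms(1)] pair_indices(1,2)[OF assms(2)] by blast+
  then have "k = l"
    using kl(3) index_eq_iff by simp
  moreover have "1 \<le> i" "1 \<le> j"
    using assms(1,2) by auto
  ultimately show ?thesis
    using kl(1,2) by auto
qed

lemma card_paired_products: "card (paired_products s a) = s div 2"
proof -
  have "paired_products s a = (\<lambda>i. a (2 * i - 1) * a (2 * i)) ` {1..s div 2}"
    by (auto simp: paired_products_def)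
  moreover have "inj_on (\<lambda>i. a (2 * i - 1) * a (2 * i)) {1..s div 2}"
  proof (rule inj_onI)
    fix i j assume ij: "i \<in> {1..s div 2}" "j \<in> {1..s div 2}"
      "a (2 * i - 1) * a (2 * i) = a (2 * j - 1) * a (2 * j)"
    then have "a (2 * i) \<in> {a (2 * j - 1), a (2 * j)}"
      using prime_mult_eq_iff[of "a (2 * i - 1)" "a (2 * i)" "a (2 * j - 1)" "a (2 * j)"]
        pair_indices[OF ij(1)] pair_indices[OF ij(2)] unmatched_index(3) by auto
    then show "i = j"
      using pair_disjoint[OF ij(1,2), of "a (2 * i)"] by blast
  qed
  ultimately show ?thesis
    by (simp add: card_image)
qed

lemma finite_paired_products: "finite (paired_products s a)"
  by (simp add: paired_products_def)

lemma paired_productE: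
  assumes "b \<in> paired_products s a"
  obtains i p q where "i \<in> {1..s div 2}" "p = a (2 * i - 1)" "q = a (2 * i)" "b = p * q"
    "p \<in> left_vertices n - fst ` greedy_matching n"
    "q \<in> left_vertices n - fst ` greedy_matching n" "p \<noteq> q"
proof -
  obtain i where i: "i \<in> {1..s div 2}" "b = a (2 * i - 1) * a (2 * i)"
    using assms by (auto simp: paired_products_def)
  show ?thesis
    using that[OF i(1) refl refl i(2)] unmatched_index pair_indices[OF i(1)]
      index_eq_iff[OF pair_indices(1,2)[OF i(1)]] by auto
qed

text \<open>This separates the two kinds of products: a paired product contributes nothing to the
  count of a right prime or of a matched left prime.\<close>

lemma paired_product_prime_dvd:
  assumes "b \<in> paired_products s a" "prime r" "r dvd b"
  shows "r \<in> left_vertices n - fst ` greedy_matching n"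
proof -
  obtain p q where pq: "b = p * q" "p \<in> left_vertices n - fst ` greedy_matching n"
    "q \<in> left_vertices n - fst ` greedy_matching n"
    using assms(1) by (rule paired_productE)
  then have "r = p \<or> r = q"
    using assms(2,3) prime_dvd_prime_mult[of p q r] by (simp add: left_vertices_iff)
  then show ?thesis
    using pq by blast
qed

lemma paired_prime_unique:
  assumes "b \<in> paired_products s a" "b' \<in> paired_products s a" "prime r" "r dvd b" "r dvd b'"
  shows "b = b'"
proof -
  obtain i p q where i: "i \<in> {1..s div 2}" "p = a (2 * i - 1)" "q = a (2 * i)" "b = p * q"
    "prime p" "prime q"
    using assms(1) by (rule paired_productE) (auto simp: left_vertices_iff)
  obtain j p' q' where j: "j \<in> {1..s div 2}" "p' = a (2 * j - 1)" "q' = a (2 * j)" "b' = p' * q'"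
    "prime p'" "prime q'"
    using assms(2) by (rule paired_productE) (auto simp: left_vertices_iff)
  have "r \<in> {p, q}" "r \<in> {p', q'}"
    using assms i j by (auto simp: prime_dvd_prime_mult)
  then have "i = j"
    using i j by (intro pair_disjoint[of i j r]) auto
  then show ?thesis
    using i j by simp
qed

lemma finite_products: "finite (matched_products n \<union> paired_products s a)"
  using finite_greedy_matching finite_paired_products by (simp add: matched_products_eq_image)

text \<open>A matched product has a right prime factor, which exceeds every left prime; both factors
  of a paired product are left primes.\<close>

lemma products_disjoint: "matched_products n \<inter> paired_products s a = {}"
proof (intro equals0I)
  fix b assume "b \<in> matched_products n \<inter> paired_products s a"
  then have b: "b \<in> matched_products n" "b \<in> paired_products s a"
    by auto
  obtain p q c where pq: "(p, q, c) \<in> greedy_matching n" "b = p * q"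
    using b(1) by (auto simp: matched_products_def)
  obtain p' q' where pq': "b = p' * q'" "p' \<in> left_vertices n" "q' \<in> left_vertices n"
    using b(2) by (rule paired_productE) blast
  have L: "p \<in> left_vertices n" "(q, c) \<in> right_vertices n"
    using greedy_edge[OF pq(1)] by auto
  have "q = p' \<or> q = q'"
    using prime_mult_eq_iff[of p q p' q'] pq pq' L
    by (auto simp: left_vertices_iff right_vertices_iff)
  then show False
    using left_less_right[OF pq'(2) L(2)] left_less_right[OF pq'(3) L(2)] by auto
qed

lemma products_not_prime_power:
  assumes "b \<in> matched_products n \<union> paired_products s a" "prime r"
  shows "b \<noteq> r ^ i"
  using assms(1)
proof
  assume "b \<in> matched_products n"
  then obtain p q c where pq: "(p, q, c) \<in> greedy_matching n" "b = p * q"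
    by (auto simp: matched_products_def)
  then show ?thesis
    using prime_mult_neq_prime_power[of p q r i] greedy_edge[OF pq(1)] left_less_right[of p n q c] assms(2)
    by (auto simp: left_vertices_iff right_vertices_iff)
next
  assume "b \<in> paired_products s a"
  then obtain p q where "b = p * q" "p \<in> left_vertices n" "q \<in> left_vertices n" "p \<noteq> q"
    by (rule paired_productE) blast
  then show ?thesis
    using prime_mult_neq_prime_power[of p q r i] assms(2) by (simp add: left_vertices_iff)
qed

lemma products_le:
  assumes "b \<in> matched_products n \<union> paired_products s a"
  shows "b \<in> {1..n}"
  using assms
proof
  assume "b \<in> matched_products n"
  then obtain p q c where pq: "(p, q, c) \<in> greedy_matching n" "b = p * q"
    by (auto simp: matched_products_def)
  then show ?thesis
    using greedy_edge[OF pq(1)] prime_gt_0_nat by (auto simp: left_vertices_iff right_vertices_iff Suc_le_eq)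
next
  assume "b \<in> paired_products s a"
  then obtain p q where pq: "b = p * q" "p \<in> left_vertices n" "q \<in> left_vertices n"
    by (rule paired_productE) blast
  \<comment> \<open>Left primes have squares at most \<open>n\<close>, so the bound on
    \<open>p * q\<close> is obtained by comparing squares.\<close>
  then have "(p * q) ^ 2 \<le> n ^ 2"
    unfolding power_mult_distrib power2_eq_square[of n]
    by (intro mult_mono) (auto simp: left_vertices_iff)
  then have "p * q \<le> n"
    by (simp only: power2_nat_le_eq_le)
  then show ?thesis
    using pq prime_gt_0_nat by (auto simp: left_vertices_iff Suc_le_eq)
qed

text \<open>A left prime is either matched, and lies on one edge, or unmatched, and lies in at most
  one pair. A right prime has two copies, each on at most one edge. Any other prime divides none of
  the products.\<close>

lemma num_multiples_products:
  assumes r: "prime r"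
  shows "num_multiples r (matched_products n \<union> paired_products s a) \<le> 3 - card (powers n r)"
proof -
  let ?X = "{b \<in> matched_products n \<union> paired_products s a. r dvd b}"
  have matched_dvd: "r = p \<or> r = q" if "(p, q, c) \<in> greedy_matching n" "r dvd p * q" for p q c
    using that greedy_edge[OF that(1)] r
    by (auto simp: left_vertices_iff right_vertices_iff prime_dvd_prime_mult)
  have fin: "finite ?X"
    using finite_products by simp
  consider (left) "r \<in> left_vertices n" | (right) "(r, 1) \<in> right_vertices n"
    | (other) "r \<notin> left_vertices n" "(r, 1) \<notin> right_vertices n"
    by blast
  then show ?thesis
  proof cases
    case left
    have "b = b'" if b: "b \<in> ?X" "b' \<in> ?X" for b b'
    proof -
      have matched: "\<exists>v. (r, v) \<in> greedy_matching n \<and> b = r * fst v"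
        if b: "b \<in> matched_products n" "r dvd b" for b
      proof -
        obtain p q c where pq: "(p, q, c) \<in> greedy_matching n" "b = p * q"
          using b by (auto simp: matched_products_def)
        moreover have "r < q"
          using greedy_edge[OF pq(1)] left left_less_right by blast
        ultimately show ?thesis
          using matched_dvd[OF pq(1)] b by force
      qed
      have paired: "r \<notin> fst ` greedy_matching n" if "b \<in> paired_products s a" "r dvd b" for b
        using paired_product_prime_dvd[OF that(1) r that(2)] by simp
      consider "b \<in> matched_products n" "b' \<in> matched_products n"
        | "b \<in> matched_products n" "b' \<in> paired_products s a"
        | "b \<in> paired_products s a" "b' \<in> matched_products n"
        | "b \<in> paired_products s a" "b' \<in> paired_products s a"
        using b by blast
      then show ?thesis
      proof cases
        case 1
        then show ?thesis
          using matched[of b] matched[of b'] b is_matching_greedy[of n] unfolding is_matching_iff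
          by blast
      next
        case 2
        then show ?thesis
          using matched[of b] paired[of b'] b by force
      next
        case 3
        then show ?thesis
          using matched[of b'] paired[of b] b by force
      next
        case 4
        then show ?thesis
          using paired_prime_unique r b by blast
      qed
    qed
    then have "card ?X \<le> 1"
      using fin by (intro card_le_Suc0_iff_eq[THEN iffD2, folded One_nat_def]) auto
    then show ?thesis
      by (simp add: num_multiples_def card_powers_left[OF left])
  next
    case right
    let ?E = "{e \<in> greedy_matching n. fst (snd e) = r}"
    have "?X \<subseteq> (\<lambda>(p, v). p * fst v) ` ?E"
    proof
      fix b assume b: "b \<in> ?X"
      have "b \<notin> paired_products s a"
        using b r left_less_right[OF _ right] paired_product_prime_dvd by blast
      then obtain p q c where pq: "(p, q, c) \<in> greedy_matching n" "b = p * q"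
        using b by (auto simp: matched_products_def)
      moreover have "p < r"
        using greedy_edge[OF pq(1)] left_less_right[OF _ right] by blast
      ultimately have "r = q"
        using matched_dvd b by blast
      then show "b \<in> (\<lambda>(p, v). p * fst v) ` ?E"
        using pq by force
    qed
    then have "card ?X \<le> card ?E"
      using finite_greedy_matching by (intro surj_card_le) auto
    \<comment> \<open>Distinct edges of the matching have distinct right ends, and the only right
      ends over \<open>r\<close> are its two copies.\<close>
    also have "\<dots> \<le> card ({r} \<times> {1, 2 :: nat})"
    proof (rule card_inj_on_le)
      show "inj_on snd ?E"
        using is_matching_greedy[of n] by (auto simp: is_matching_def inj_on_def)
      show "snd ` ?E \<subseteq> {r} \<times> {1, 2}"
      proof
        fix v assume "v \<in> snd ` ?E"
        then obtain p where "(p, v) \<in> greedy_matching n" "fst v = r"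
          by auto
        then show "v \<in> {r} \<times> {1, 2}"
          using greedy_edge(2)[of p v] by (cases v) (auto simp: right_vertices_iff)
      qed
    qed simp
    finally show ?thesis
      by (simp add: num_multiples_def card_powers_right[OF right])
  next
    case other
    have "?X = {}"
    proof (intro equals0I)
      fix b assume b: "b \<in> ?X"
      then consider "b \<in> matched_products n" | "b \<in> paired_products s a"
        by blast
      then show False
      proof cases
        case 1
        then obtain p q c where pq: "(p, q, c) \<in> greedy_matching n" "b = p * q"
          by (auto simp: matched_products_def)
        then show False
          using matched_dvd[OF pq(1)] b greedy_edge[OF pq(1)] other
          by (auto simp: right_vertices_iff)
      next
        case 2
        then show False
          using b r other paired_product_prime_dvd by blast
      qed
    qed
    then show ?thesis
      unfolding num_multiples_def by (simp only: card.empty)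
  qed
qed

section \<open>The construction is a shelf, and its size\<close>

lemma shelf_construction:
  assumes "n \<ge> 1"
  shows "shelf n 3 ({1} \<union> prime_powers n \<union> matched_products n \<union> paired_products s a)"
  unfolding shelf_def
proof (intro conjI allI impI)
  show "{1} \<union> prime_powers n \<union> matched_products n \<union> paired_products s a \<subseteq> {1..n}"
    using assms products_le by (auto simp: prime_powers_def Suc_le_eq prime_gt_0_nat)
next
  fix r :: nat assume r: "prime r"
  let ?P = "matched_products n \<union> paired_products s a"
  have pow: "{b \<in> prime_powers n. r dvd b} \<subseteq> powers n r"
  proof
    fix b assume b: "b \<in> {b \<in> prime_powers n. r dvd b}"
    then obtain p i where p: "prime p" "i \<in> {1, 2, 3}" "b = p ^ i" "p ^ i \<le> n"
      unfolding prime_powers_def by blast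
    then have "r = p"
      using b r prime_dvd_power[of r p i] primes_dvd_imp_eq[of r p] by simp
    then show "b \<in> powers n r"
      unfolding powers_def using p by blast
  qed
  have "num_multiples r ({1} \<union> prime_powers n \<union> matched_products n \<union> paired_products s a)
      \<le> card (powers n r \<union> {b \<in> ?P. r dvd b})"
    unfolding num_multiples_def
  proof (rule card_mono)
    show "finite (powers n r \<union> {b \<in> ?P. r dvd b})"
      using finite_powers finite_products by simp
    show "{b \<in> {1} \<union> prime_powers n \<union> matched_products n \<union> paired_products s a. r dvd b}
        \<subseteq> powers n r \<union> {b \<in> ?P. r dvd b}"
      using pow r by auto
  qed
  also have "\<dots> \<le> card (powers n r) + num_multiples r ?P"
    unfolding num_multiples_def by (rule card_Un_le)
  \<comment> \<open>The products take up at most what the powers of \<open>r\<close> leave of 3, and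
    the powers themselves number at most 3.\<close>
  finally show "num_multiples r ({1} \<union> prime_powers n \<union> matched_products n \<union> paired_products s a) \<le> 3"
    using num_multiples_products[OF r] card_powers_le[of n r] by linarith
qed

text \<open>The four parts are pairwise disjoint, and with \<open>s = |F(n)|\<close> the total is
  exactly the upper bound obtained for an arbitrary shelf.\<close>

lemma card_construction:
  "card ({1} \<union> prime_powers n \<union> matched_products n \<union> paired_products s a) =
     1 + (\<Sum>p | prime p \<and> p \<le> n. card (powers n p)) + (card (greedy_matching n) + s div 2)"
proof -
  let ?P = "matched_products n \<union> paired_products s a"
  have fin: "finite (prime_powers n)" "finite (matched_products n)"
    using finite_greedy_matching
    by (auto simp: prime_powers_eq_Union finite_powers matched_products_eq_image)
  have "1 < p ^ i" if "prime p" "i \<in> {1, 2, 3}" for p i :: nat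
    using that by (intro one_less_power prime_gt_1_nat) auto
  then have "1 < x" if "x \<in> prime_powers n" for x
    using that unfolding prime_powers_def by blast
  then have "1 \<notin> prime_powers n"
    by blast
  then have "card ({1} \<union> prime_powers n) = 1 + card (prime_powers n)"
    using fin by simp
  moreover have "({1} \<union> prime_powers n) \<inter> ?P = {}"
  proof -
    \<comment> \<open>The number 1 counts as the prime power \<open>2 ^ 0\<close>, so it is not one
      of the products.\<close>
    have "1 \<notin> ?P"
      using products_not_prime_power[of 1 2 0] by auto
    moreover have "x \<notin> ?P" if "x \<in> prime_powers n" for x
      using that products_not_prime_power[of x] unfolding prime_powers_def by blast
    ultimately show ?thesis
      by blast
  qed
  then have "card (({1} \<union> prime_powers n) \<union> ?P) = card ({1} \<union> prime_powers n) + card ?P"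
    using fin finite_paired_products by (intro card_Un_disjoint) auto
  moreover have "card ?P = card (greedy_matching n) + s div 2"
    using fin finite_paired_products products_disjoint
    by (simp add: card_Un_disjoint card_matched_products card_paired_products)
  ultimately show ?thesis
    by (simp add: card_prime_powers Un_assoc)
qed

end

theorem theorem1:
  fixes n s :: nat and a :: "nat \<Rightarrow> nat"
  assumes "n \<ge> 1"
    and "bij_betw a {1..s} (unmatched_left n)"
  shows "maximum_shelf n 3
           ({1}
            \<union> {p ^ i | p i. prime p \<and> i \<in> {1, 2, 3} \<and> p ^ i \<le> n}
            \<union> {p * q | p q c. (p, q, c) \<in> greedy_matching n}
            \<union> {a (2 * i - 1) * a (2 * i) | i. i \<in> {1..s div 2}})"
  unfolding prime_powers_def[symmetric] matched_products_def[symmetric]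
    paired_products_def[symmetric] maximum_shelf_def
proof (intro conjI allI impI)
  show "shelf n 3 ({1} \<union> prime_powers n \<union> matched_products n \<union> paired_products s a)"
    by (rule shelf_construction[OF assms(2,1)])
next
  fix B assume B: "shelf n 3 B"
  show "card B \<le> card ({1} \<union> prime_powers n \<union> matched_products n \<union> paired_products s a)"
  proof (rule shelf_saturating_subset[OF B])
    fix S
    assume S: "S \<subseteq> B" "\<And>b p i. b \<in> S \<Longrightarrow> prime p \<Longrightarrow> b \<noteq> p ^ i"
      "\<And>p. prime p \<Longrightarrow> num_multiples p S \<le> 3 - card (powers n p)"
      "card B \<le> 1 + (\<Sum>p | prime p \<and> p \<le> n. card (powers n p)) + card S"
    have "S \<subseteq> {1..n}"
      using S(1) B by (auto simp: shelf_def)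
    then have "card S \<le> card (greedy_matching n) + card (unmatched_left n) div 2"
      using S(2,3) by (rule card_saturating_le)
    \<comment> \<open>The enumeration identifies \<open>s\<close> with \<open>|F(n)|\<close>, which
      makes the bound on \<open>S\<close> equal to the number of products in the
      construction.\<close>
    moreover have "card (unmatched_left n) = s"
      using bij_betw_same_card[OF assms(2)] by simp
    ultimately show ?thesis
      using S(4) unfolding card_construction[OF assms(2)] by linarith
  qed
qed

end
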